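(* Consider a two-armed bandit in which both arms yield rewards distributed as Bernoulli$(q)$, played by Thompson Sampling with Beta priors. Let $N_1(n)$ be the number of pulls of arm 1 up to and including time $n$. Then, as $n\to\infty$: (I) If $q=0$, then $\frac{N_1(n)}{n}\Rightarrow\frac12$. (II) If $q=1$, then $\frac{N_1(n)}{n}\Rightarrow$ the Uniform distribution on $[0,1]$.
   Context: Thompson Sampling for the two-armed Bernoulli bandit. Initialize the numbers of successes and failures of each arm $i\in\{1,2\}$ as $(S_i,F_i)=(0,0)$. At each time $t=1,2,\dots$: sample, independently across arms and (given the current counts) independently of the past, $\mathcal{T}_i\sim\mathrm{Beta}(S_i+1,F_i+1)$ for $i\in\{1,2\}$; play an arm $\pi_t\in\arg\max_{i\in\{1,2\}}\mathcal{T}_i$ and observe its reward $r_t\in\{0,1\}$; update $S_{\pi_t}\gets S_{\pi_t}+r_t$ and $F_{\pi_t}\gets F_{\pi_t}+1-r_t$. The rewards of each arm are i.i.d. over pulls and independent across arms. $\Rightarrow$ denotes weak convergence (convergence in distribution). *)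

theory Defs
  imports "HOL-Probability.Probability"
begin

definition beta_density :: "real \<Rightarrow> real \<Rightarrow> real \<Rightarrow> real" where
  "beta_density a b x =
     (if 0 < x \<and> x < 1 then x powr (a - 1) * (1 - x) powr (b - 1) / Beta a b else 0)"

definition beta_distribution :: "real \<Rightarrow> real \<Rightarrow> real measure" where
  "beta_distribution a b = density lborel (\<lambda>x. ennreal (beta_density a b x))"

text \<open>
  The arms are the natural numbers 1 and 2. A run of the bandit is described by
  \<^item> \<open>arm t \<omega>\<close>, the arm played at time \<open>t \<ge> 1\<close>;
  \<^item> \<open>X i k \<omega>\<close>, whether the pull of arm \<open>i\<close> that is preceded by \<open>k\<close> pulls of
    that arm yields reward 1 (otherwise it yields reward 0).
\<close>

definition pulls :: "(nat \<Rightarrow> 'a \<Rightarrow> nat) \<Rightarrow> nat \<Rightarrow> nat \<Rightarrow> 'a \<Rightarrow> nat" where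
  "pulls arm i n \<omega> = card {t \<in> {1..n}. arm t \<omega> = i}"

definition rewarded ::
  "(nat \<Rightarrow> 'a \<Rightarrow> nat) \<Rightarrow> (nat \<Rightarrow> nat \<Rightarrow> 'a \<Rightarrow> bool) \<Rightarrow> nat \<Rightarrow> 'a \<Rightarrow> bool" where
  "rewarded arm X t \<omega> \<longleftrightarrow> X (arm t \<omega>) (pulls arm (arm t \<omega>) (t - 1) \<omega>) \<omega>"

text \<open>Numbers of successes and failures of arm \<open>i\<close> after the update at time \<open>t\<close>.\<close>

primrec successes ::
  "(nat \<Rightarrow> 'a \<Rightarrow> nat) \<Rightarrow> (nat \<Rightarrow> nat \<Rightarrow> 'a \<Rightarrow> bool) \<Rightarrow> nat \<Rightarrow> nat \<Rightarrow> 'a \<Rightarrow> nat" where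
  "successes arm X i 0 \<omega> = 0"
| "successes arm X i (Suc t) \<omega> =
     successes arm X i t \<omega> + of_bool (arm (Suc t) \<omega> = i \<and> rewarded arm X (Suc t) \<omega>)"

primrec failures ::
  "(nat \<Rightarrow> 'a \<Rightarrow> nat) \<Rightarrow> (nat \<Rightarrow> nat \<Rightarrow> 'a \<Rightarrow> bool) \<Rightarrow> nat \<Rightarrow> nat \<Rightarrow> 'a \<Rightarrow> nat" where
  "failures arm X i 0 \<omega> = 0"
| "failures arm X i (Suc t) \<omega> =
     failures arm X i t \<omega> + of_bool (arm (Suc t) \<omega> = i \<and> \<not> rewarded arm X (Suc t) \<omega>)"

text \<open>
  The sigma-algebra generated by all samples \<open>\<T> i s\<close> and plays \<open>arm s\<close> up to time \<open>t\<close>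
  and by the rewards. All entries of the reward table are included, not only those already
  observed: this expresses that the sampling randomness does not anticipate future rewards.
\<close>

definition past ::
  "'a measure \<Rightarrow> (nat \<Rightarrow> nat \<Rightarrow> 'a \<Rightarrow> real) \<Rightarrow> (nat \<Rightarrow> 'a \<Rightarrow> nat) \<Rightarrow>
   (nat \<Rightarrow> nat \<Rightarrow> 'a \<Rightarrow> bool) \<Rightarrow> nat \<Rightarrow> 'a measure" where
  "past M \<T> arm X t = sigma (space M)
     ({\<T> i s -` A \<inter> space M | i s A. i \<in> {1, 2} \<and> s \<in> {1..t} \<and> A \<in> sets borel} \<union>
      {arm s -` A \<inter> space M | s A. s \<in> {1..t}} \<union>
      {X i k -` A \<inter> space M | i k A. i \<in> {1, 2}})"

text \<open>
  Thompson Sampling on a two-armed Bernoulli bandit whose arm \<open>i\<close> has success probability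
  \<open>p i\<close>. Nothing is assumed about how ties between the two samples are broken.
\<close>

locale thompson_sampling = prob_space M
  for M :: "'a measure" +
  fixes p :: "nat \<Rightarrow> real"
    and \<T> :: "nat \<Rightarrow> nat \<Rightarrow> 'a \<Rightarrow> real"
    and arm :: "nat \<Rightarrow> 'a \<Rightarrow> nat"
    and X :: "nat \<Rightarrow> nat \<Rightarrow> 'a \<Rightarrow> bool"
  assumes success_prob: "i \<in> {1, 2} \<Longrightarrow> p i \<in> {0..1}"
    and rewards_indep:
      "indep_vars (\<lambda>_. count_space UNIV) (\<lambda>(i, k). X i k) ({1, 2} \<times> UNIV)"
    and rewards_bernoulli:
      "i \<in> {1, 2} \<Longrightarrow> distr M (count_space UNIV) (X i k) = measure_pmf (bernoulli_pmf (p i))"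
    and samples_measurable: "i \<in> {1, 2} \<Longrightarrow> t \<ge> 1 \<Longrightarrow> \<T> i t \<in> borel_measurable M"
    and arm_measurable: "t \<ge> 1 \<Longrightarrow> arm t \<in> M \<rightarrow>\<^sub>M count_space UNIV"
    and samples_beta:
      "A \<in> sets borel \<Longrightarrow> B \<in> sets borel \<Longrightarrow>
       AE \<omega> in M.
         real_cond_exp M (past M \<T> arm X t)
           (indicator {\<omega>'. \<T> 1 (Suc t) \<omega>' \<in> A \<and> \<T> 2 (Suc t) \<omega>' \<in> B}) \<omega> =
         measure (beta_distribution (real (successes arm X 1 t \<omega>) + 1)
                                    (real (failures arm X 1 t \<omega>) + 1)) A *
         measure (beta_distribution (real (successes arm X 2 t \<omega>) + 1)
                                    (real (failures arm X 2 t \<omega>) + 1)) B"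
    and arm_argmax:
      "t \<ge> 1 \<Longrightarrow> \<omega> \<in> space M \<Longrightarrow> is_arg_max (\<lambda>i. \<T> i t \<omega>) (\<lambda>i. i \<in> {1, 2}) (arm t \<omega>)"
begin

text \<open>
  The library's \<open>real_cond_exp M F\<close> is only meaningful if \<open>F\<close> is a sub-sigma-algebra of \<open>M\<close>.
\<close>

lemma subalgebra_past: "subalgebra M (past M \<T> arm X t)"
proof -
  have X: "X i k \<in> M \<rightarrow>\<^sub>M count_space UNIV" if "i \<in> {1, 2}" for i k
    using rewards_indep that by (force simp: indep_vars_def)
  have sub: "{\<T> i s -` A \<inter> space M | i s A. i \<in> {1, 2} \<and> s \<in> {1..t} \<and> A \<in> sets borel} \<union>
      {arm s -` A \<inter> space M | s A. s \<in> {1..t}} \<union>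
      {X i k -` A \<inter> space M | i k A. i \<in> {1, 2}} \<subseteq> sets M" (is "?G \<subseteq> _")
    using measurable_sets[OF samples_measurable] measurable_sets[OF arm_measurable]
      measurable_sets[OF X]
    by fastforce
  moreover have "?G \<subseteq> Pow (space M)"
    using sub sets.space_closed by blast
  ultimately show ?thesis
    unfolding subalgebra_def past_def
    by (simp only: sets_measure_of space_measure_of sets.sigma_sets_subset)
qed

end

end

theory Submission
  imports Defs "HOL-Real_Asymp.Real_Asymp"
begin

text \<open>
  For deterministic rewards the counts of an arm after \<open>k\<close> pulls are \<open>(k, 0)\<close> or \<open>(0, k)\<close>, so the
  samples have laws \<open>Beta(k + 1, 1)\<close> (if \<open>q = 1\<close>) or \<open>Beta(1, k + 1)\<close> (if \<open>q = 0\<close>). Given \<open>k\<close> pulls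
  of arm 1 up to time \<open>t\<close>, arm 1 is therefore played next with probability \<open>(k + 1) / (t + 2)\<close>,
  respectively \<open>(t - k + 1) / (t + 2)\<close>. For \<open>q = 1\<close> this is Polya's urn: \<open>N\<^sub>1(n)\<close> is uniform on
  \<open>{0..n}\<close>. For \<open>q = 0\<close> the drift of \<open>D = 2 N\<^sub>1(t) - t\<close> points towards 0, hence \<open>E D\<^sup>2 \<le> t\<close>, and
  Chebyshev's inequality applies.
\<close>

subsection \<open>Comparing two beta distributed samples\<close>

text \<open>Fundamental theorem of calculus with antiderivative \<open>t ^ Suc m\<close>. The
  endpoints are null sets, and \<open>0 \<le> a\<close> keeps the integrand nonnegative. Open
  intervals match the support of \<open>beta_density\<close>.\<close>

lemma nn_integral_power_Ioo:
  fixes a b :: real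
  assumes "0 \<le> a" "a \<le> b"
  shows "(\<integral>\<^sup>+t. ennreal (real (Suc m) * t ^ m) * indicator {a<..<b} t \<partial>lborel)
    = ennreal (b ^ Suc m - a ^ Suc m)"
proof -
  have "(\<integral>\<^sup>+t. ennreal (real (Suc m) * t ^ m) * indicator {a<..<b} t \<partial>lborel)
    = (\<integral>\<^sup>+t. ennreal (real (Suc m) * t ^ m) * indicator {a..b} t \<partial>lborel)"
    using AE_lborel_singleton[of a] AE_lborel_singleton[of b]
    by (intro nn_integral_cong_AE) (auto split: split_indicator)
  also have "\<dots> = ennreal (b ^ Suc m - a ^ Suc m)"
    using assms
    by (intro nn_integral_FTC_Icc) (auto intro!: DERIV_power_Suc[THEN DERIV_cong] derivative_eq_intros
      simp del: power_Suc)
  finally show ?thesis .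
qed

text \<open>Mirror image under \<open>t \<mapsto> 1 - t\<close>: the antiderivative is
  \<open>- ((1 - t) ^ Suc m)\<close>, and \<open>b \<le> 1\<close> keeps the integrand
  nonnegative.\<close>

lemma nn_integral_power_one_minus_Ioo:
  fixes a b :: real
  assumes "a \<le> b" "b \<le> 1"
  shows "(\<integral>\<^sup>+t. ennreal (real (Suc m) * (1 - t) ^ m) * indicator {a<..<b} t \<partial>lborel)
    = ennreal ((1 - a) ^ Suc m - (1 - b) ^ Suc m)"
proof -
  have "(\<integral>\<^sup>+t. ennreal (real (Suc m) * (1 - t) ^ m) * indicator {a<..<b} t \<partial>lborel)
    = (\<integral>\<^sup>+t. ennreal (real (Suc m) * (1 - t) ^ m) * indicator {a..b} t \<partial>lborel)"
    using AE_lborel_singleton[of a] AE_lborel_singleton[of b]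
    by (intro nn_integral_cong_AE) (auto split: split_indicator)
  also have "\<dots> = ennreal (- ((1 - b) ^ Suc m) - - ((1 - a) ^ Suc m))"
    using assms
    by (intro nn_integral_FTC_Icc) (auto intro!: DERIV_power_Suc[THEN DERIV_cong] derivative_eq_intros
      simp del: power_Suc)
  finally show ?thesis by simp
qed

lemma sets_beta_distribution [simp, measurable_cong]: "sets (beta_distribution a b) = sets borel"
  by (simp add: beta_distribution_def)

lemma space_beta_distribution [simp]: "space (beta_distribution a b) = UNIV"
  by (simp add: beta_distribution_def)

lemma measurable_beta_density [measurable]: "beta_density a b \<in> borel_measurable borel"
  unfolding beta_density_def by measurable

text \<open>Functional equation of Gamma: Gamma(m + 2) = (m + 1) Gamma(m + 1), so the quotient
  defining Beta collapses.\<close>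

lemma Beta_Suc_1: "Beta (real m + 1) 1 = 1 / real (Suc m)"
proof -
  have "(real m + 1) \<notin> \<int>\<^sub>\<le>\<^sub>0" by (auto elim!: nonpos_Ints_cases')
  then have "Gamma (real m + 1 + 1) = (real m + 1) * Gamma (real m + 1)"
    by (intro Gamma_plus1) (metis add.right_neutral not_less_iff_gr_or_eq of_nat_0_less_iff of_nat_Suc add.commute zero_less_Suc)
  moreover have "Gamma (real m + 1) > 0" by (intro Gamma_real_pos) simp
  then have "Gamma (real m + 1) \<noteq> 0" by linarith
  ultimately show ?thesis
    by (simp add: Beta_def add.commute)
qed

text \<open>One of the two exponents is 0, so on the open unit interval a single factor survives,
  and \<open>powr\<close> becomes a natural power there.\<close>

lemma beta_density_Suc_1:
  "beta_density (real m + 1) 1 x = real (Suc m) * x ^ m * indicator {0<..<1} x"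
  by (auto simp: beta_density_def Beta_Suc_1 powr_realpow)

lemma beta_density_1_Suc:
  "beta_density 1 (real m + 1) x = real (Suc m) * (1 - x) ^ m * indicator {0<..<1} x"
  by (auto simp: beta_density_def Beta_Suc_1 Beta_commute[of 1] powr_realpow)

lemma nn_integral_beta_Suc_1:
  assumes [measurable]: "f \<in> borel_measurable borel"
  shows "(\<integral>\<^sup>+x. f x \<partial>beta_distribution (real m + 1) 1) =
    (\<integral>\<^sup>+x. ennreal (real (Suc m) * x ^ m) * indicator {0<..<1} x * f x \<partial>lborel)"
  unfolding beta_distribution_def
  by (subst nn_integral_density)
    (auto simp: beta_density_Suc_1 simp del: of_nat_Suc intro!: nn_integral_cong split: split_indicator)

lemma nn_integral_beta_1_Suc:
  assumes [measurable]: "f \<in> borel_measurable borel"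
  shows "(\<integral>\<^sup>+x. f x \<partial>beta_distribution 1 (real m + 1)) =
    (\<integral>\<^sup>+x. ennreal (real (Suc m) * (1 - x) ^ m) * indicator {0<..<1} x * f x \<partial>lborel)"
  unfolding beta_distribution_def
  by (subst nn_integral_density)
    (auto simp: beta_density_1_Suc simp del: of_nat_Suc intro!: nn_integral_cong split: split_indicator)

lemma prob_space_beta_Suc_1: "prob_space (beta_distribution (real m + 1) 1)"
proof
  show "emeasure (beta_distribution (real m + 1) 1) (space (beta_distribution (real m + 1) 1)) = 1"
    using nn_integral_beta_Suc_1[of "\<lambda>_. 1" m] nn_integral_power_Ioo[of 0 1 m] by simp
qed

lemma prob_space_beta_1_Suc: "prob_space (beta_distribution 1 (real m + 1))"
proof
  show "emeasure (beta_distribution 1 (real m + 1)) (space (beta_distribution 1 (real m + 1))) = 1"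
    using nn_integral_beta_1_Suc[of "\<lambda>_. 1" m] nn_integral_power_one_minus_Ioo[of 0 1 m] by simp
qed

lemma emeasure_beta_Suc_1_lessThan:
  assumes "0 < x" "x < 1"
  shows "emeasure (beta_distribution (real m + 1) 1) {..<x} = ennreal (x ^ Suc m)"
proof -
  have "emeasure (beta_distribution (real m + 1) 1) {..<x} =
      (\<integral>\<^sup>+t. ennreal (real (Suc m) * t ^ m) * indicator {0<..<1} t * indicator {..<x} t \<partial>lborel)"
    by (subst nn_integral_beta_Suc_1[symmetric]) auto
  also have "\<dots> = (\<integral>\<^sup>+t. ennreal (real (Suc m) * t ^ m) * indicator {0<..<x} t \<partial>lborel)"
    using assms by (intro nn_integral_cong) (auto split: split_indicator)
  also have "\<dots> = ennreal (x ^ Suc m)"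
    using assms by (subst nn_integral_power_Ioo) auto
  finally show ?thesis .
qed

text \<open>For Beta(1, m + 1) it is the upper tail, not the distribution function, that is a pure
  power.\<close>

lemma emeasure_beta_1_Suc_greaterThan:
  assumes "0 < x" "x < 1"
  shows "emeasure (beta_distribution 1 (real m + 1)) {x<..} = ennreal ((1 - x) ^ Suc m)"
proof -
  have "emeasure (beta_distribution 1 (real m + 1)) {x<..} =
      (\<integral>\<^sup>+t. ennreal (real (Suc m) * (1 - t) ^ m) * indicator {0<..<1} t * indicator {x<..} t \<partial>lborel)"
    by (subst nn_integral_beta_1_Suc[symmetric]) auto
  also have "\<dots> = (\<integral>\<^sup>+t. ennreal (real (Suc m) * (1 - t) ^ m) * indicator {x<..<1} t \<partial>lborel)"
    using assms by (intro nn_integral_cong) (auto split: split_indicator)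
  also have "\<dots> = ennreal ((1 - x) ^ Suc m)"
    using assms by (subst nn_integral_power_one_minus_Ioo) auto
  finally show ?thesis .
qed

text \<open>The density of Beta(m + 1, 1) times the distribution function of Beta(k + 1, 1) is a
  constant multiple of the density of Beta(m + k + 2, 1). With \<open>y = 1 - x\<close> the same
  identity serves the mirrored laws.\<close>

lemma power_rescale:
  "real (Suc m) * y ^ m * y ^ Suc k
    = real (Suc m) / real (m + k + 2) * (real (Suc (m + Suc k)) * y ^ (m + Suc k))"
proof -
  have "real (m + k + 2) = real (Suc (m + Suc k))" by simp
  moreover have "real (Suc (m + Suc k)) > 0" by simp
  ultimately show ?thesis
    by (simp only: power_add) (simp del: of_nat_Suc of_nat_add)
qed

lemma sets_less_pair:
  fixes M N :: "real measure"
  assumes [measurable_cong]: "sets M = sets borel" "sets N = sets borel"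
  shows "{(x, y). y < x} \<in> sets (M \<Otimes>\<^sub>M N)" and "{(x, y). x < y} \<in> sets (M \<Otimes>\<^sub>M N)"
proof -
  have sp: "space (M \<Otimes>\<^sub>M N) = UNIV"
    using assms[THEN sets_eq_imp_space_eq] by (simp add: space_pair_measure)
  have "Measurable.pred (M \<Otimes>\<^sub>M N) (\<lambda>(x, y). y < x)" "Measurable.pred (M \<Otimes>\<^sub>M N) (\<lambda>(x, y). x < y)"
    by measurable
  then show "{(x, y). y < x} \<in> sets (M \<Otimes>\<^sub>M N)" and "{(x, y). x < y} \<in> sets (M \<Otimes>\<^sub>M N)"
    by (auto simp: pred_def sp)
qed

text \<open>This is P(Y < X) for independent X ~ Beta(m + 1, 1) and Y ~ Beta(k + 1, 1). By
  \<open>power_rescale\<close> the integrand is a constant times a probability density, and that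
  constant is the value.\<close>

lemma nn_integral_beta_Suc_1_lessThan:
  "(\<integral>\<^sup>+x. emeasure (beta_distribution (real k + 1) 1) {..<x} \<partial>beta_distribution (real m + 1) 1)
    = ennreal (real (Suc m) / real (m + k + 2))" (is "?L = _")
proof -
  interpret prob_space "beta_distribution (real k + 1) 1" by (rule prob_space_beta_Suc_1)
  have "{(x, y). y < x} \<in> sets (borel \<Otimes>\<^sub>M beta_distribution (real k + 1) 1)"
    by (rule sets_less_pair) simp_all
  from measurable_emeasure_Pair[OF this]
  have "(\<lambda>x. emeasure (beta_distribution (real k + 1) 1) {..<x}) \<in> borel_measurable borel"
    by (simp add: vimage_def lessThan_def)
  then have "?L = (\<integral>\<^sup>+x. ennreal (real (Suc m) * x ^ m) * indicator {0<..<1} x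
      * emeasure (beta_distribution (real k + 1) 1) {..<x} \<partial>lborel)"
    by (rule nn_integral_beta_Suc_1)
  also have "\<dots> = (\<integral>\<^sup>+x. ennreal (real (Suc m) / real (m + k + 2)) *
      (ennreal (real (Suc (m + Suc k)) * x ^ (m + Suc k)) * indicator {0<..<1} x) \<partial>lborel)"
    using power_rescale[of m _ k]
    by (intro nn_integral_cong)
      (auto simp: emeasure_beta_Suc_1_lessThan ennreal_mult[symmetric]
        simp del: of_nat_Suc of_nat_add power_Suc split: split_indicator)
  also have "\<dots> = ennreal (real (Suc m) / real (m + k + 2)) * ennreal (1 ^ Suc (m + Suc k) - 0 ^ Suc (m + Suc k))"
    by (subst nn_integral_cmult, measurable, subst nn_integral_power_Ioo) auto
  finally show ?thesis by simp
qed

text \<open>The mirrored comparison: P(Y > X) for independent X ~ Beta(1, m + 1) and Y ~ Beta(1, k +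
  1).\<close>

lemma nn_integral_beta_1_Suc_greaterThan:
  "(\<integral>\<^sup>+x. emeasure (beta_distribution 1 (real k + 1)) {x<..} \<partial>beta_distribution 1 (real m + 1))
    = ennreal (real (Suc m) / real (m + k + 2))" (is "?L = _")
proof -
  interpret prob_space "beta_distribution 1 (real k + 1)" by (rule prob_space_beta_1_Suc)
  have "{(x, y). x < y} \<in> sets (borel \<Otimes>\<^sub>M beta_distribution 1 (real k + 1))"
    by (rule sets_less_pair) simp_all
  from measurable_emeasure_Pair[OF this]
  have "(\<lambda>x. emeasure (beta_distribution 1 (real k + 1)) {x<..}) \<in> borel_measurable borel"
    by (simp add: vimage_def greaterThan_def)
  then have "?L = (\<integral>\<^sup>+x. ennreal (real (Suc m) * (1 - x) ^ m) * indicator {0<..<1} x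
      * emeasure (beta_distribution 1 (real k + 1)) {x<..} \<partial>lborel)"
    by (rule nn_integral_beta_1_Suc)
  also have "\<dots> = (\<integral>\<^sup>+x. ennreal (real (Suc m) / real (m + k + 2)) *
      (ennreal (real (Suc (m + Suc k)) * (1 - x) ^ (m + Suc k)) * indicator {0<..<1} x) \<partial>lborel)"
    using power_rescale[of m _ k]
    by (intro nn_integral_cong)
      (auto simp: emeasure_beta_1_Suc_greaterThan ennreal_mult[symmetric]
        simp del: of_nat_Suc of_nat_add power_Suc split: split_indicator)
  also have "\<dots> = ennreal (real (Suc m) / real (m + k + 2)) *
      ennreal ((1 - 0) ^ Suc (m + Suc k) - (1 - 1) ^ Suc (m + Suc k))"
    by (subst nn_integral_cmult, measurable, subst nn_integral_power_one_minus_Ioo) auto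
  finally show ?thesis by simp
qed

text \<open>Fubini in both orders. Both orders are wanted because the inner measure should be a pure
  power: a lower tail for Beta(m + 1, 1), an upper tail for Beta(1, m + 1).\<close>

lemma emeasure_pair_less:
  fixes M N :: "real measure"
  assumes "prob_space M" "prob_space N" and [measurable_cong]: "sets M = sets borel" "sets N = sets borel"
  shows "emeasure (M \<Otimes>\<^sub>M N) {(x, y). y < x} = (\<integral>\<^sup>+x. emeasure N {..<x} \<partial>M)"
    and "emeasure (M \<Otimes>\<^sub>M N) {(x, y). y < x} = (\<integral>\<^sup>+y. emeasure M {y<..} \<partial>N)"
    and "emeasure (M \<Otimes>\<^sub>M N) {(x, y). x < y} = (\<integral>\<^sup>+x. emeasure N {x<..} \<partial>M)"
    and "emeasure (M \<Otimes>\<^sub>M N) {(x, y). x < y} = (\<integral>\<^sup>+y. emeasure M {..<y} \<partial>N)"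
proof -
  interpret M: prob_space M by fact
  interpret N: prob_space N by fact
  interpret pair_sigma_finite M N ..
  note * = sets_less_pair[OF assms(3,4)]
  show "emeasure (M \<Otimes>\<^sub>M N) {(x, y). y < x} = (\<integral>\<^sup>+x. emeasure N {..<x} \<partial>M)"
    and "emeasure (M \<Otimes>\<^sub>M N) {(x, y). x < y} = (\<integral>\<^sup>+x. emeasure N {x<..} \<partial>M)"
    by (subst N.emeasure_pair_measure_alt, use * in simp, simp add: vimage_def lessThan_def greaterThan_def)+
  show "emeasure (M \<Otimes>\<^sub>M N) {(x, y). y < x} = (\<integral>\<^sup>+y. emeasure M {y<..} \<partial>N)"
    and "emeasure (M \<Otimes>\<^sub>M N) {(x, y). x < y} = (\<integral>\<^sup>+y. emeasure M {..<y} \<partial>N)"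
    by (subst emeasure_pair_measure_alt2, use * in simp, simp add: vimage_def lessThan_def greaterThan_def)+
qed

subsection \<open>Transition probabilities\<close>

text \<open>The flag \<open>b\<close> is the common value of all rewards, so that both cases share
  one transition lemma. The truncated difference \<open>t - k\<close> is the true one only for
  \<open>k \<le> t\<close>.\<close>

definition arm1_prob :: "bool \<Rightarrow> nat \<Rightarrow> nat \<Rightarrow> real" where
  "arm1_prob b t k = (if b then real (Suc k) else real (Suc (t - k))) / real (t + 2)"

lemma pulls_0 [simp]: "pulls arm i 0 \<omega> = 0"
  by (simp add: pulls_def)

lemma pulls_Suc:
  "pulls arm i (Suc t) \<omega> = pulls arm i t \<omega> + of_bool (arm (Suc t) \<omega> = i)"
proof -
  have "{s \<in> {1..Suc t}. arm s \<omega> = i} =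
      {s \<in> {1..t}. arm s \<omega> = i} \<union> (if arm (Suc t) \<omega> = i then {Suc t} else {})"
    by (auto simp: le_Suc_eq)
  then show ?thesis
    by (simp add: pulls_def)
qed

context thompson_sampling
begin

lemma arm_cases:
  assumes "t \<ge> 1" "\<omega> \<in> space M"
  shows "arm t \<omega> = 1 \<or> arm t \<omega> = 2"
  using arm_argmax[OF assms] by (simp add: is_arg_max_def)

text \<open>Only a strict inequality between the samples pins the arm down; at a tie either arm may
  be played.\<close>

lemma arm_eq_1:
  assumes "t \<ge> 1" "\<omega> \<in> space M" "\<T> 2 t \<omega> < \<T> 1 t \<omega>"
  shows "arm t \<omega> = 1"
  using arm_argmax[OF assms(1,2)] assms(3) by (auto simp: is_arg_max_def)

lemma arm_eq_2:
  assumes "t \<ge> 1" "\<omega> \<in> space M" "\<T> 1 t \<omega> < \<T> 2 t \<omega>"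
  shows "arm t \<omega> = 2"
  using arm_argmax[OF assms(1,2)] assms(3) by (auto simp: is_arg_max_def)

lemma pulls_1_plus_pulls_2:
  assumes "\<omega> \<in> space M"
  shows "pulls arm 1 t \<omega> + pulls arm 2 t \<omega> = t"
proof (induction t)
  case (Suc t)
  then show ?case
    using arm_cases[of "Suc t", OF _ assms] by (auto simp: pulls_Suc)
qed simp

section \<open>Measurability of plays and pull counts with respect to the past\<close>

lemma space_past [simp]: "space (past M \<T> arm X t) = space M"
  using subalgebra_past by (simp add: subalgebra_def)

lemma arm_measurable_past:
  assumes "s \<in> {1..t}"
  shows "arm s \<in> past M \<T> arm X t \<rightarrow>\<^sub>M count_space UNIV"
proof (rule measurableI)
  fix A :: "nat set"
  let ?G = "{\<T> i s -` A \<inter> space M | i s A. i \<in> {1, 2} \<and> s \<in> {1..t} \<and> A \<in> sets borel} \<union>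
      {arm s -` A \<inter> space M | s A. s \<in> {1..t}} \<union>
      {X i k -` A \<inter> space M | i k A. i \<in> {1, 2}}"
  have "?G \<subseteq> Pow (space M)" by auto
  then have G: "?G \<subseteq> sets (past M \<T> arm X t)"
    unfolding past_def by (simp only: sets_measure_of) (rule sigma_sets_superset_generator)
  have "arm s -` A \<inter> space M \<in> ?G"
    using assms by blast
  from subsetD[OF G this]
  show "arm s -` A \<inter> space (past M \<T> arm X t) \<in> sets (past M \<T> arm X t)"
    by (simp only: space_past)
qed simp

text \<open>The count is a sum of indicators of plays up to time \<open>s\<close>. This puts the
  event that arm 1 has \<open>k\<close> pulls into the past, so the conditional law of the samples
  can be integrated over it.\<close>

lemma pulls_measurable_past:
  "s \<le> t \<Longrightarrow> pulls arm i s \<in> past M \<T> arm X t \<rightarrow>\<^sub>M count_space UNIV"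
proof (induction s)
  case 0
  have "pulls arm i 0 = (\<lambda>_. 0)" by (rule ext) simp
  then show ?case by simp
next
  case (Suc s)
  then have [measurable]: "pulls arm i s \<in> past M \<T> arm X t \<rightarrow>\<^sub>M count_space UNIV" by simp
  have [measurable]: "arm (Suc s) \<in> past M \<T> arm X t \<rightarrow>\<^sub>M count_space UNIV"
    using Suc.prems by (intro arm_measurable_past) auto
  have "(\<lambda>\<omega>. pulls arm i s \<omega> + (if arm (Suc s) \<omega> = i then 1 else 0))
      \<in> past M \<T> arm X t \<rightarrow>\<^sub>M count_space UNIV"
    by measurable
  then show ?case
    by (simp add: pulls_Suc[abs_def] of_bool_def)
qed

lemma pulls_measurable [measurable]: "pulls arm i t \<in> M \<rightarrow>\<^sub>M count_space UNIV"
  using measurable_from_subalg[OF subalgebra_past pulls_measurable_past[OF order_refl]] .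

section \<open>Joint law of the two samples on an event of the past\<close>

text \<open>\<open>samples_beta\<close> speaks of rectangles only, whereas comparing two samples
  needs half-planes. On \<open>E\<close> the counts are constant, so the conditional law is a fixed
  product; integrating over \<open>E\<close> settles rectangles, and uniqueness of product measures
  extends this to every Borel set \<open>C\<close>.\<close>

lemma joint_law_samples:
  assumes E: "E \<in> sets (past M \<T> arm X t)"
    and state: "AE \<omega> in M. \<omega> \<in> E \<longrightarrow>
      successes arm X 1 t \<omega> = s1 \<and> failures arm X 1 t \<omega> = f1 \<and>
      successes arm X 2 t \<omega> = s2 \<and> failures arm X 2 t \<omega> = f2"
    and B1: "prob_space B1" "B1 = beta_distribution (real s1 + 1) (real f1 + 1)"
    and B2: "prob_space B2" "B2 = beta_distribution (real s2 + 1) (real f2 + 1)"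
    and C: "C \<in> sets (borel \<Otimes>\<^sub>M borel)"
  shows "emeasure M ({\<omega> \<in> space M. (\<T> 1 (Suc t) \<omega>, \<T> 2 (Suc t) \<omega>) \<in> C} \<inter> E)
    = emeasure M E * emeasure (B1 \<Otimes>\<^sub>M B2) C"
proof -
  interpret B1: prob_space B1 by fact
  interpret B2: prob_space B2 by fact
  interpret P: sigma_finite_subalgebra M "past M \<T> arm X t"
    by (intro finite_measure_subalgebra_is_sigma_finite finite_measure_subalgebra.intro
        finite_measure_axioms finite_measure_subalgebra_axioms.intro subalgebra_past)
  have EM[measurable]: "E \<in> sets M" using E subalgebra_past by (auto simp: subalgebra_def)
  have T: "\<T> 1 (Suc t) \<in> borel_measurable M" "\<T> 2 (Suc t) \<in> borel_measurable M"
    by (auto intro!: samples_measurable)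
  note [measurable] = T T(1)[unfolded One_nat_def]
  have [measurable_cong, simp]: "sets B1 = sets borel" "sets B2 = sets borel"
    using B1(2) B2(2) by simp_all
  \<comment> \<open>The mass of \<open>E\<close> is absorbed into the first factor, so the law of
    the samples restricted to \<open>E\<close>, which is \<open>D\<close>, should itself be a
    product. No division by the possibly vanishing probability of \<open>E\<close> occurs.\<close>
  define S where "S = scale_measure (emeasure M E) B1"
  define D where "D = distr (density M (indicator E)) (borel \<Otimes>\<^sub>M borel)
    (\<lambda>\<omega>. (\<T> 1 (Suc t) \<omega>, \<T> 2 (Suc t) \<omega>))"
  have [measurable_cong, simp]: "sets S = sets borel" by (simp add: S_def)
  have D: "emeasure D A = emeasure M ({\<omega> \<in> space M. (\<T> 1 (Suc t) \<omega>, \<T> 2 (Suc t) \<omega>) \<in> A} \<inter> E)"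
    if [measurable]: "A \<in> sets (borel \<Otimes>\<^sub>M borel)" for A
  proof -
    have "emeasure D A = emeasure (density M (indicator E))
        ((\<lambda>\<omega>. (\<T> 1 (Suc t) \<omega>, \<T> 2 (Suc t) \<omega>)) -` A \<inter> space M)"
      unfolding D_def by (subst emeasure_distr) auto
    also have "\<dots> = emeasure M (((\<lambda>\<omega>. (\<T> 1 (Suc t) \<omega>, \<T> 2 (Suc t) \<omega>)) -` A \<inter> space M) \<inter> E)"
      by (subst emeasure_restricted) (auto simp: Int_commute)
    also have "((\<lambda>\<omega>. (\<T> 1 (Suc t) \<omega>, \<T> 2 (Suc t) \<omega>)) -` A \<inter> space M) =
        {\<omega> \<in> space M. (\<T> 1 (Suc t) \<omega>, \<T> 2 (Suc t) \<omega>) \<in> A}"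
      by auto
    finally show ?thesis .
  qed
  have "S \<Otimes>\<^sub>M B2 = D"
  proof (rule pair_measure_eqI)
    have "finite_measure S"
      by (rule finite_measureI) (simp add: S_def space_scale_measure ennreal_mult_eq_top_iff)
    then show "sigma_finite_measure S" by (simp add: finite_measure_def)
    show "sigma_finite_measure B2" ..
    show "sets (S \<Otimes>\<^sub>M B2) = sets D"
      by (simp add: D_def cong: sets_pair_measure_cong)
    fix A B assume "A \<in> sets S" "B \<in> sets B2"
    then have [measurable]: "A \<in> sets borel" "B \<in> sets borel" by simp_all
    \<comment> \<open>\<open>Q\<close> is left unrestricted to match the indicator in
      \<open>samples_beta\<close>; measurability holds for its trace on
      \<open>space M\<close>.\<close>
    define Q where "Q = {\<omega>'. \<T> 1 (Suc t) \<omega>' \<in> A \<and> \<T> 2 (Suc t) \<omega>' \<in> B}"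
    have [measurable]: "Q \<inter> space M \<in> sets M"
    proof -
      have "{\<omega> \<in> space M. \<T> 1 (Suc t) \<omega> \<in> A \<and> \<T> 2 (Suc t) \<omega> \<in> B} \<in> sets M"
        by measurable
      also have "{\<omega> \<in> space M. \<T> 1 (Suc t) \<omega> \<in> A \<and> \<T> 2 (Suc t) \<omega> \<in> B} = Q \<inter> space M"
        by (auto simp: Q_def)
      finally show ?thesis .
    qed
    have intQ: "integrable M (indicat_real Q)"
      by (subst integrable_indicator_iff) (auto simp: emeasure_eq_measure)
    have "prob (Q \<inter> space M \<inter> E) = (\<integral>\<omega>. indicator (Q \<inter> space M \<inter> E) \<omega> \<partial>M)"
      by (simp add: Int_ac)
    also have "\<dots> = (\<integral>\<omega>\<in>E. indicator Q \<omega> \<partial>M)"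
      unfolding set_lebesgue_integral_def
      by (intro Bochner_Integration.integral_cong) (auto split: split_indicator)
    \<comment> \<open>Defining property of conditional expectation, available because
      \<open>E\<close> belongs to the past.\<close>
    also have "\<dots> = (\<integral>\<omega>\<in>E. real_cond_exp M (past M \<T> arm X t) (indicator Q) \<omega> \<partial>M)"
      by (rule P.real_cond_exp_intA[OF intQ E])
    also have "\<dots> = (\<integral>\<omega>. measure B1 A * measure B2 B * indicator E \<omega> \<partial>M)"
      unfolding set_lebesgue_integral_def
    proof (rule integral_cong_AE)
      \<comment> \<open>On \<open>E\<close> the counts take their prescribed values, so the
        conditional probability is constant; off \<open>E\<close> both sides vanish.\<close>
      show "AE \<omega> in M. indicat_real E \<omega> *\<^sub>R real_cond_exp M (past M \<T> arm X t) (indicator Q) \<omega>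
          = measure B1 A * measure B2 B * indicator E \<omega>"
        using samples_beta[of A B t, folded Q_def, simplified] state
        by eventually_elim (simp add: B1(2) B2(2) split: split_indicator)
    qed measurable
    also have "\<dots> = measure B1 A * measure B2 B * prob E"
      using EM by simp
    finally have *: "prob (Q \<inter> space M \<inter> E) = measure B1 A * measure B2 B * prob E" .
    have "emeasure D (A \<times> B) = emeasure M (Q \<inter> space M \<inter> E)"
      by (subst D) (auto intro!: arg_cong[where f = "emeasure M"] simp: Q_def)
    also have "\<dots> = emeasure S A * emeasure B2 B"
      using * by (simp add: S_def emeasure_eq_measure B1.emeasure_eq_measure B2.emeasure_eq_measure
        ennreal_mult[symmetric] mult_ac)
    finally show "emeasure S A * emeasure B2 B = emeasure D (A \<times> B)" ..
  qed
  then have "emeasure D C = emeasure (S \<Otimes>\<^sub>M B2) C" by simp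
  moreover have C': "C \<in> sets (S \<Otimes>\<^sub>M B2)" "C \<in> sets (B1 \<Otimes>\<^sub>M B2)"
    using C by (simp_all cong: sets_pair_measure_cong)
  have "emeasure (S \<Otimes>\<^sub>M B2) C = emeasure M E * emeasure (B1 \<Otimes>\<^sub>M B2) C"
    unfolding B2.emeasure_pair_measure_alt[OF C'(1)] B2.emeasure_pair_measure_alt[OF C'(2)]
    using B2.measurable_emeasure_Pair[OF C'(2)] by (simp add: S_def nn_integral_scale_measure)
  ultimately show ?thesis using D[OF C] by simp
qed

section \<open>Counts and next play under deterministic rewards\<close>

text \<open>A Bernoulli law with parameter 0 or 1 is a point mass.\<close>

lemma AE_rewards:
  assumes "i \<in> {1, 2}" "p i = of_bool b"
  shows "AE \<omega> in M. X i k \<omega> = b"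
proof -
  have X: "X i k \<in> M \<rightarrow>\<^sub>M count_space UNIV"
    using rewards_indep assms(1) by (force simp: indep_vars_def)
  have "AE x in measure_pmf (bernoulli_pmf (p i)). x = b"
    unfolding AE_measure_pmf_iff
  proof
    fix x assume "x \<in> set_pmf (bernoulli_pmf (p i))"
    with assms(2) show "x = b" by (cases b; cases x) (auto simp: set_pmf_iff)
  qed
  then show ?thesis
    unfolding rewards_bernoulli[OF assms(1), of k, symmetric] using X by (simp add: AE_distr_iff)
qed

text \<open>The reward table is countable, so outside one null set all its entries equal
  \<open>b\<close>. There every pull of an arm raises the same counter.\<close>

lemma AE_state:
  assumes "p 1 = of_bool b" "p 2 = of_bool b"
  shows "AE \<omega> in M. \<forall>i t. i \<in> {1, 2} \<longrightarrow>
    successes arm X i t \<omega> = (if b then pulls arm i t \<omega> else 0) \<and>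
    failures arm X i t \<omega> = (if b then 0 else pulls arm i t \<omega>)"
proof -
  have "AE \<omega> in M. \<forall>k. X 1 k \<omega> = b" "AE \<omega> in M. \<forall>k. X 2 k \<omega> = b"
    using assms by (auto simp: AE_all_countable intro!: AE_rewards)
  with AE_space show ?thesis
  proof eventually_elim
    case (elim \<omega>)
    show ?case
    proof (intro allI impI conjI)
      fix i t
      have r: "rewarded arm X (Suc t) \<omega> = b" for t
        using arm_cases[of "Suc t" \<omega>] elim by (auto simp: rewarded_def)
      show "successes arm X i t \<omega> = (if b then pulls arm i t \<omega> else 0)"
        by (induction t) (auto simp: r pulls_Suc)
      show "failures arm X i t \<omega> = (if b then 0 else pulls arm i t \<omega>)"
        by (induction t) (auto simp: r pulls_Suc)
    qed
  qed
qed

text \<open>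
  Only lower bounds are available for the two arms separately, because ties are broken
  arbitrarily; as they add up to the probability of the conditioning event, both are attained.
\<close>

lemma prob_arm_Suc:
  assumes E: "E \<in> sets (past M \<T> arm X t)"
    and state: "AE \<omega> in M. \<omega> \<in> E \<longrightarrow>
      successes arm X 1 t \<omega> = s1 \<and> failures arm X 1 t \<omega> = f1 \<and>
      successes arm X 2 t \<omega> = s2 \<and> failures arm X 2 t \<omega> = f2"
    and B1: "prob_space B1" "B1 = beta_distribution (real s1 + 1) (real f1 + 1)"
    and B2: "prob_space B2" "B2 = beta_distribution (real s2 + 1) (real f2 + 1)"
    and w: "0 \<le> w1" "0 \<le> w2" "w1 + w2 = 1"
      "emeasure (B1 \<Otimes>\<^sub>M B2) {(x, y). y < x} = ennreal w1"
      "emeasure (B1 \<Otimes>\<^sub>M B2) {(x, y). x < y} = ennreal w2"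
  shows "prob ({\<omega> \<in> space M. arm (Suc t) \<omega> = 1} \<inter> E) = w1 * prob E"
    and "prob ({\<omega> \<in> space M. arm (Suc t) \<omega> = 2} \<inter> E) = w2 * prob E"
proof -
  have [measurable]: "E \<in> sets M" using E subalgebra_past by (auto simp: subalgebra_def)
  have [measurable]: "arm (Suc t) \<in> M \<rightarrow>\<^sub>M count_space UNIV" by (rule arm_measurable) simp
  let ?A = "\<lambda>i. {\<omega> \<in> space M. arm (Suc t) \<omega> = i} \<inter> E"
  let ?L = "\<lambda>C. {\<omega> \<in> space M. (\<T> 1 (Suc t) \<omega>, \<T> 2 (Suc t) \<omega>) \<in> C} \<inter> E"
  have sets: "{(x, y). y < x} \<in> sets (borel \<Otimes>\<^sub>M borel :: (real \<times> real) measure)"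
    "{(x, y). x < y} \<in> sets (borel \<Otimes>\<^sub>M borel :: (real \<times> real) measure)"
    by (simp_all add: sets_less_pair)
  have "prob (?L {(x, y). y < x}) = w1 * prob E" "prob (?L {(x, y). x < y}) = w2 * prob E"
    using sets[THEN joint_law_samples[OF E state B1 B2]] w
    by (simp_all add: emeasure_eq_measure ennreal_mult[symmetric] mult.commute)
  moreover have "prob (?L {(x, y). y < x}) \<le> prob (?A 1)" "prob (?L {(x, y). x < y}) \<le> prob (?A 2)"
    by (intro finite_measure_mono; use arm_eq_1[of "Suc t"] arm_eq_2[of "Suc t"] in auto)+
  moreover have "prob (?A 1) + prob (?A 2) = prob E"
  proof -
    have "?A 1 \<union> ?A 2 = E"
      using arm_cases[of "Suc t"] sets.sets_into_space[OF \<open>E \<in> sets M\<close>] by auto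
    moreover have "prob (?A 1 \<union> ?A 2) = prob (?A 1) + prob (?A 2)"
      by (rule finite_measure_Union) auto
    ultimately show ?thesis by simp
  qed
  moreover have "w1 * prob E + w2 * prob E = prob E"
    using w(3) by (metis distrib_right mult_1)
  ultimately show "prob (?A 1) = w1 * prob E" "prob (?A 2) = w2 * prob E"
    by linarith+
qed

text \<open>The count of arm 1 at time \<open>t\<close> determines that of arm 2, so fixing it
  freezes both posteriors. The beta comparison then supplies the weights for
  \<open>prob_arm_Suc\<close>.\<close>

lemma prob_arm_Suc_pulls:
  assumes "p 1 = of_bool b" "p 2 = of_bool b" "k \<le> t"
  shows "prob ({\<omega> \<in> space M. arm (Suc t) \<omega> = 1} \<inter> {\<omega> \<in> space M. pulls arm 1 t \<omega> = k})
      = arm1_prob b t k * prob {\<omega> \<in> space M. pulls arm 1 t \<omega> = k}" (is "?P1")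
    and "prob ({\<omega> \<in> space M. arm (Suc t) \<omega> = 2} \<inter> {\<omega> \<in> space M. pulls arm 1 t \<omega> = k})
      = (1 - arm1_prob b t k) * prob {\<omega> \<in> space M. pulls arm 1 t \<omega> = k}" (is "?P2")
proof -
  let ?E = "{\<omega> \<in> space M. pulls arm 1 t \<omega> = k}"
  have "{\<omega> \<in> space (past M \<T> arm X t). pulls arm 1 t \<omega> = k} \<in> sets (past M \<T> arm X t)"
    using pulls_measurable_past[OF order_refl, of 1 t] by measurable
  then have E: "?E \<in> sets (past M \<T> arm X t)" by (simp only: space_past)
  have state: "AE \<omega> in M. \<omega> \<in> ?E \<longrightarrow>
      successes arm X 1 t \<omega> = (if b then k else 0) \<and> failures arm X 1 t \<omega> = (if b then 0 else k) \<and>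
      successes arm X 2 t \<omega> = (if b then t - k else 0) \<and> failures arm X 2 t \<omega> = (if b then 0 else t - k)"
    using AE_state[OF assms(1,2)]
  proof eventually_elim
    case (elim \<omega>)
    show ?case
    proof
      assume "\<omega> \<in> ?E"
      then have "pulls arm 1 t \<omega> = k" "pulls arm 2 t \<omega> = t - k"
        using pulls_1_plus_pulls_2[of \<omega> t] by auto
      then show "successes arm X 1 t \<omega> = (if b then k else 0) \<and> failures arm X 1 t \<omega> = (if b then 0 else k) \<and>
        successes arm X 2 t \<omega> = (if b then t - k else 0) \<and> failures arm X 2 t \<omega> = (if b then 0 else t - k)"
        using elim by auto
    qed
  qed
  \<comment> \<open>The posterior after \<open>m\<close> pulls: Beta(m + 1, 1) if all succeeded,
    Beta(1, m + 1) if all failed.\<close>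
  let ?B = "\<lambda>m. beta_distribution (real (if b then m else 0) + 1) (real (if b then 0 else m) + 1)"
  have B: "prob_space (?B m)" for m
    using prob_space_beta_Suc_1[of m] prob_space_beta_1_Suc[of m] by simp
  have w: "0 \<le> arm1_prob b t k" "0 \<le> 1 - arm1_prob b t k" "arm1_prob b t k + (1 - arm1_prob b t k) = 1"
    using assms(3) by (auto simp: arm1_prob_def)
  have less: "emeasure (?B k \<Otimes>\<^sub>M ?B (t - k)) {(x, y). y < x} = ennreal (arm1_prob b t k)"
  proof (cases b)
    case True
    then show ?thesis
      using emeasure_pair_less(1)[OF B B, of k "t - k"] nn_integral_beta_Suc_1_lessThan[of k "t - k"] assms(3)
      by (simp add: arm1_prob_def)
  next
    case False
    then show ?thesis
      using emeasure_pair_less(2)[OF B B, of k "t - k"] nn_integral_beta_1_Suc_greaterThan[of "t - k" k] assms(3)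
      by (simp add: arm1_prob_def)
  qed
  have greater: "emeasure (?B k \<Otimes>\<^sub>M ?B (t - k)) {(x, y). x < y} = ennreal (1 - arm1_prob b t k)"
  proof (cases b)
    case True
    \<comment> \<open>The complementary weight has the same form with \<open>k\<close> and
      \<open>t - k\<close> exchanged, as (k + 1) + (t - k + 1) = t + 2.\<close>
    have "1 - arm1_prob b t k = real (Suc (t - k)) / real (t - k + k + 2)"
      using True assms(3) by (simp add: arm1_prob_def field_simps of_nat_diff)
    with True show ?thesis
      using emeasure_pair_less(4)[OF B B, of k "t - k"] nn_integral_beta_Suc_1_lessThan[of "t - k" k] assms(3)
      by simp
  next
    case False
    have "1 - arm1_prob b t k = real (Suc k) / real (k + (t - k) + 2)"
      using False assms(3) by (simp add: arm1_prob_def field_simps of_nat_diff)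
    with False show ?thesis
      using emeasure_pair_less(3)[OF B B, of k "t - k"] nn_integral_beta_1_Suc_greaterThan[of k "t - k"] assms(3)
      by simp
  qed
  from prob_arm_Suc[OF E state B refl B refl w less greater] show ?P1 ?P2 .
qed

section \<open>Expectations of functions of the pull count\<close>

lemma pulls_le: "\<omega> \<in> space M \<Longrightarrow> pulls arm 1 t \<omega> \<le> t"
  using pulls_1_plus_pulls_2[of \<omega> t] by simp

text \<open>The count takes only the values 0 to \<open>t\<close>, so any function of it is a finite
  combination of indicators.\<close>

lemma expectation_pulls_sum:
  fixes f :: "nat \<Rightarrow> real"
  shows "integrable M (\<lambda>\<omega>. f (pulls arm 1 t \<omega>))"
    and "expectation (\<lambda>\<omega>. f (pulls arm 1 t \<omega>))
      = (\<Sum>k\<le>t. f k * prob {\<omega> \<in> space M. pulls arm 1 t \<omega> = k})"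
proof -
  let ?g = "\<lambda>\<omega>. \<Sum>k\<le>t. f k * indicator {\<omega> \<in> space M. pulls arm 1 t \<omega> = k} \<omega>"
  have eq: "f (pulls arm 1 t \<omega>) = ?g \<omega>" if "\<omega> \<in> space M" for \<omega>
  proof -
    have "?g \<omega> = (\<Sum>k\<le>t. if k = pulls arm 1 t \<omega> then f k else 0)"
      using that by (intro sum.cong) auto
    then show ?thesis using pulls_le[OF that, of t] by simp
  qed
  have *: "integrable M (indicat_real {\<omega> \<in> space M. pulls arm 1 t \<omega> = k})" for k
    by (subst integrable_indicator_iff) (auto simp: emeasure_eq_measure)
  have "integrable M ?g"
    by (intro Bochner_Integration.integrable_sum integrable_mult_right *)
  then show "integrable M (\<lambda>\<omega>. f (pulls arm 1 t \<omega>))"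
    by (subst Bochner_Integration.integrable_cong[OF refl eq])
  have "expectation (\<lambda>\<omega>. f (pulls arm 1 t \<omega>)) = expectation ?g"
    by (rule Bochner_Integration.integral_cong[OF refl eq])
  also have "\<dots> = (\<Sum>k\<le>t. f k * prob {\<omega> \<in> space M. pulls arm 1 t \<omega> = k})"
  proof (subst Bochner_Integration.integral_sum)
    show "(\<Sum>k\<le>t. expectation (\<lambda>\<omega>. f k * indicator {\<omega> \<in> space M. pulls arm 1 t \<omega> = k} \<omega>))
        = (\<Sum>k\<le>t. f k * prob {\<omega> \<in> space M. pulls arm 1 t \<omega> = k})"
      by (simp add: Int_absorb2 Collect_restrict del: indicator_simps)
  qed (intro integrable_mult_right *)
  finally show "expectation (\<lambda>\<omega>. f (pulls arm 1 t \<omega>))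
      = (\<Sum>k\<le>t. f k * prob {\<omega> \<in> space M. pulls arm 1 t \<omega> = k})" .
qed

text \<open>One step of the Markov chain of counts. The events given by the current count
  \<open>k\<close> and the next arm partition the space, and on each of them the new count is
  constant.\<close>

lemma expectation_pulls_Suc:
  fixes f :: "nat \<Rightarrow> real"
  assumes "p 1 = of_bool b" "p 2 = of_bool b"
  shows "expectation (\<lambda>\<omega>. f (pulls arm 1 (Suc t) \<omega>)) =
    (\<Sum>k\<le>t. (arm1_prob b t k * f (Suc k) + (1 - arm1_prob b t k) * f k)
      * prob {\<omega> \<in> space M. pulls arm 1 t \<omega> = k})"
proof -
  let ?E = "\<lambda>k. {\<omega> \<in> space M. pulls arm 1 t \<omega> = k}"
  let ?A = "\<lambda>i. {\<omega> \<in> space M. arm (Suc t) \<omega> = i}"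
  let ?g = "\<lambda>\<omega>. \<Sum>k\<le>t. f (Suc k) * indicator (?A 1 \<inter> ?E k) \<omega> + f k * indicator (?A 2 \<inter> ?E k) \<omega>"
  have [measurable]: "arm (Suc t) \<in> M \<rightarrow>\<^sub>M count_space UNIV" by (rule arm_measurable) simp
  have eq: "f (pulls arm 1 (Suc t) \<omega>) = ?g \<omega>" if "\<omega> \<in> space M" for \<omega>
  proof -
    have "?g \<omega> = (\<Sum>k\<le>t. if k = pulls arm 1 t \<omega> then f (pulls arm 1 (Suc t) \<omega>) else 0)"
      using that arm_cases[of "Suc t" \<omega>] by (intro sum.cong) (auto simp: pulls_Suc)
    then show ?thesis using pulls_le[OF that, of t] by simp
  qed
  have *: "integrable M (indicat_real (?A i \<inter> ?E k))" for i k
    by (subst integrable_indicator_iff) (auto simp: emeasure_eq_measure)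
  have "expectation (\<lambda>\<omega>. f (pulls arm 1 (Suc t) \<omega>)) = expectation ?g"
    by (rule Bochner_Integration.integral_cong[OF refl eq])
  also have "\<dots> = (\<Sum>k\<le>t. f (Suc k) * prob (?A 1 \<inter> ?E k) + f k * prob (?A 2 \<inter> ?E k))"
    using * by (subst Bochner_Integration.integral_sum) (auto simp: Int_absorb2 le_infI1)
  also have "\<dots> = (\<Sum>k\<le>t. (arm1_prob b t k * f (Suc k) + (1 - arm1_prob b t k) * f k) * prob (?E k))"
  proof (intro sum.cong refl)
    fix k assume "k \<in> {..t}"
    then have "k \<le> t" by simp
    show "f (Suc k) * prob (?A 1 \<inter> ?E k) + f k * prob (?A 2 \<inter> ?E k) =
      (arm1_prob b t k * f (Suc k) + (1 - arm1_prob b t k) * f k) * prob (?E k)"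
      unfolding prob_arm_Suc_pulls[OF assms \<open>k \<le> t\<close>] by (simp add: algebra_simps)
  qed
  finally show ?thesis .
qed

subsection \<open>Limits of the proportion\<close>

text \<open>Uniformity of the count on \<open>{0..t}\<close>, tested against functions. Since
  \<open>f\<close> is arbitrary in the induction, the hypothesis can be applied to the image
  \<open>?g\<close> of \<open>f\<close> under the transition operator.\<close>

lemma expectation_pulls_all_succeed:
  fixes f :: "nat \<Rightarrow> real"
  assumes "p 1 = 1" "p 2 = 1"
  shows "expectation (\<lambda>\<omega>. f (pulls arm 1 t \<omega>)) = (\<Sum>k\<le>t. f k) / real (t + 1)"
proof (induction t arbitrary: f)
  case 0
  then show ?case by (simp add: prob_space)
next
  case (Suc t)
  let ?g = "\<lambda>k. arm1_prob True t k * f (Suc k) + (1 - arm1_prob True t k) * f k"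
  have "expectation (\<lambda>\<omega>. f (pulls arm 1 (Suc t) \<omega>)) = expectation (\<lambda>\<omega>. ?g (pulls arm 1 t \<omega>))"
    unfolding expectation_pulls_sum(2)[of ?g] using assms by (intro expectation_pulls_Suc) auto
  also have "\<dots> = (\<Sum>k\<le>t. ?g k) / real (t + 1)" by (rule Suc.IH)
  also have "(\<Sum>k\<le>t. ?g k)
      = (\<Sum>k\<le>t. real (Suc k) * f (Suc k) + (real (Suc t) - real k) * f k) / real (t + 2)"
    unfolding sum_divide_distrib
  proof (intro sum.cong refl)
    fix k
    have "1 - arm1_prob True t k = (real (Suc t) - real k) / real (t + 2)"
      by (simp add: arm1_prob_def field_simps)
    moreover have "arm1_prob True t k = real (Suc k) / real (t + 2)"
      by (simp add: arm1_prob_def)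
    ultimately show "?g k = (real (Suc k) * f (Suc k) + (real (Suc t) - real k) * f k) / real (t + 2)"
      by (simp only: times_divide_eq_left add_divide_distrib)
  qed
  \<comment> \<open>After the index shift both sums extend to \<open>Suc t\<close>, because the
    added terms, at 0 in the first and at \<open>Suc t\<close> in the second, have weight 0.\<close>
  also have "(\<Sum>k\<le>t. real (Suc k) * f (Suc k) + (real (Suc t) - real k) * f k)
      = (\<Sum>k\<le>Suc t. real k * f k) + (\<Sum>k\<le>Suc t. (real (Suc t) - real k) * f k)"
  proof -
    have "(\<Sum>k\<le>Suc t. real k * f k) = (\<Sum>k\<le>t. real (Suc k) * f (Suc k))"
      by (subst sum.atMost_Suc_shift) simp
    moreover have "(\<Sum>k\<le>Suc t. (real (Suc t) - real k) * f k) = (\<Sum>k\<le>t. (real (Suc t) - real k) * f k)"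
      by simp
    ultimately show ?thesis by (simp only: sum.distrib)
  qed
  \<comment> \<open>State \<open>k\<close> receives weight \<open>k\<close> from below and
    \<open>Suc t - k\<close> by staying. The total does not depend on \<open>k\<close> and cancels
    the denominator \<open>t + 1\<close> of the induction hypothesis.\<close>
  also have "\<dots> = real (Suc t) * (\<Sum>k\<le>Suc t. f k)"
    unfolding sum.distrib[symmetric] sum_distrib_left by (intro sum.cong) (auto simp: algebra_simps)
  finally show ?case by (simp add: add.commute)
qed

text \<open>Write D for twice the count minus the time. It moves by 1 up or down, so its square
  grows in conditional mean by 1 plus a cross term; the drift opposes the sign of D, so the cross
  term is at most 0.\<close>

lemma second_moment_pulls_all_fail:
  assumes "p 1 = 0" "p 2 = 0"
  shows "expectation (\<lambda>\<omega>. (2 * real (pulls arm 1 t \<omega>) - real t)\<^sup>2) \<le> real t"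
proof (induction t)
  case 0
  then show ?case by simp
next
  case (Suc t)
  let ?d = "\<lambda>k. 2 * real k - real t"
  let ?f = "\<lambda>k. (2 * real k - real (Suc t))\<^sup>2"
  have "expectation (\<lambda>\<omega>. ?f (pulls arm 1 (Suc t) \<omega>)) =
      (\<Sum>k\<le>t. (arm1_prob False t k * ?f (Suc k) + (1 - arm1_prob False t k) * ?f k)
        * prob {\<omega> \<in> space M. pulls arm 1 t \<omega> = k})"
    using assms by (intro expectation_pulls_Suc) auto
  also have "\<dots> \<le> (\<Sum>k\<le>t. ((?d k)\<^sup>2 + 1) * prob {\<omega> \<in> space M. pulls arm 1 t \<omega> = k})"
  proof (intro sum_mono mult_right_mono)
    fix k assume "k \<in> {..t}"
    then have "real (Suc (t - k)) = real t - real k + 1" by (simp add: of_nat_diff)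
    then have "2 * arm1_prob False t k - 1 = - ?d k / real (t + 2)"
      by (simp add: arm1_prob_def field_simps)
    moreover have "x * (- x / real (t + 2)) = - (x\<^sup>2 / real (t + 2))" for x
      by (simp add: power2_eq_square)
    ultimately have "?d k * (2 * arm1_prob False t k - 1) = - ((?d k)\<^sup>2 / real (t + 2))"
      by (simp only:)
    then have "?d k * (2 * arm1_prob False t k - 1) \<le> 0" by simp
    \<comment> \<open>The bases of the squares are \<open>?d k + 1\<close> if arm 1 is played and
      \<open>?d k - 1\<close> otherwise.\<close>
    moreover have "arm1_prob False t k * ?f (Suc k) + (1 - arm1_prob False t k) * ?f k
        = (?d k)\<^sup>2 + 1 + 2 * (?d k * (2 * arm1_prob False t k - 1))"
      by (simp add: power2_eq_square algebra_simps)
    ultimately show "arm1_prob False t k * ?f (Suc k) + (1 - arm1_prob False t k) * ?f k \<le> (?d k)\<^sup>2 + 1"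
      by simp
  qed simp
  also have "\<dots> = expectation (\<lambda>\<omega>. (?d (pulls arm 1 t \<omega>))\<^sup>2 + 1)"
    by (rule expectation_pulls_sum(2)[symmetric])
  also have "\<dots> = expectation (\<lambda>\<omega>. (?d (pulls arm 1 t \<omega>))\<^sup>2) + 1"
    using Bochner_Integration.integral_add[OF expectation_pulls_sum(1)[of "\<lambda>k. (?d k)\<^sup>2" t], of "\<lambda>_. 1"]
    by (simp add: prob_space)
  finally show ?case using Suc.IH by simp
qed

section \<open>Weak limit when every reward is 0\<close>

lemma prob_pulls_deviation_all_fail:
  assumes "p 1 = 0" "p 2 = 0" "\<epsilon> > 0" "n > 0"
  shows "prob {\<omega> \<in> space M. \<epsilon> \<le> \<bar>real (pulls arm 1 n \<omega>) / real n - 1 / 2\<bar>} \<le> 1 / (4 * \<epsilon>\<^sup>2 * real n)"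
proof -
  let ?D = "\<lambda>\<omega>. 2 * real (pulls arm 1 n \<omega>) - real n"
  \<comment> \<open>The deviation of the proportion from 1/2 is \<open>?D\<close> divided by
    \<open>2 * real n\<close>; squaring prepares Markov's inequality for the second moment.\<close>
  have "\<epsilon> \<le> \<bar>real (pulls arm 1 n \<omega>) / real n - 1 / 2\<bar> \<longleftrightarrow> (2 * \<epsilon> * real n)\<^sup>2 \<le> (?D \<omega>)\<^sup>2" for \<omega>
  proof -
    have "\<bar>real (pulls arm 1 n \<omega>) / real n - 1 / 2\<bar> = \<bar>?D \<omega> / (2 * real n)\<bar>"
      using assms(4) by (intro arg_cong[where f = abs]) (simp add: field_simps)
    also have "\<dots> = \<bar>?D \<omega>\<bar> / (2 * real n)" by simp
    finally have "\<epsilon> \<le> \<bar>real (pulls arm 1 n \<omega>) / real n - 1 / 2\<bar> \<longleftrightarrow> 2 * \<epsilon> * real n \<le> \<bar>?D \<omega>\<bar>"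
      using assms(4) by (simp add: field_simps)
    also have "\<dots> \<longleftrightarrow> (2 * \<epsilon> * real n)\<^sup>2 \<le> (?D \<omega>)\<^sup>2"
      using assms(3) by (subst abs_le_square_iff[symmetric]) simp
    finally show ?thesis .
  qed
  then have "prob {\<omega> \<in> space M. \<epsilon> \<le> \<bar>real (pulls arm 1 n \<omega>) / real n - 1 / 2\<bar>}
      = prob {\<omega> \<in> space M. (2 * \<epsilon> * real n)\<^sup>2 \<le> (?D \<omega>)\<^sup>2}"
    by simp
  also have "\<dots> \<le> expectation (\<lambda>\<omega>. (?D \<omega>)\<^sup>2) / (2 * \<epsilon> * real n)\<^sup>2"
    using assms(3,4) expectation_pulls_sum(1)[of "\<lambda>k. (2 * real k - real n)\<^sup>2" n]
    by (intro integral_Markov_inequality_measure[where A = "space M"]) auto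
  also have "\<dots> \<le> real n / (2 * \<epsilon> * real n)\<^sup>2"
    using second_moment_pulls_all_fail[OF assms(1,2)] by (intro divide_right_mono) auto
  also have "\<dots> = 1 / (4 * \<epsilon>\<^sup>2 * real n)"
    using assms(3,4) by (simp add: field_simps power2_eq_square)
  finally show ?thesis .
qed

lemma cdf_proportion:
  "cdf (distr M borel (\<lambda>\<omega>. real (pulls arm 1 n \<omega>) / real n)) x
    = prob {\<omega> \<in> space M. real (pulls arm 1 n \<omega>) / real n \<le> x}"
proof -
  have "(\<lambda>\<omega>. real (pulls arm 1 n \<omega>) / real n) -` {..x} \<inter> space M
      = {\<omega> \<in> space M. real (pulls arm 1 n \<omega>) / real n \<le> x}"
    by auto
  then show ?thesis by (simp add: cdf_def measure_distr)
qed

lemma weak_conv_all_fail: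
  assumes "p 1 = 0" "p 2 = 0"
  shows "weak_conv_m (\<lambda>n. distr M borel (\<lambda>\<omega>. real (pulls arm 1 n \<omega>) / real n)) (return borel (1 / 2))"
  unfolding weak_conv_m_def weak_conv_def
proof (intro allI impI)
  fix x :: real
  assume cont: "isCont (cdf (return borel (1 / 2))) x"
  interpret R: prob_space "return borel (1 / 2 :: real)" by (rule prob_space_return) simp
  interpret R: real_distribution "return borel (1 / 2 :: real)" by standard simp_all
  let ?P = "\<lambda>n. prob {\<omega> \<in> space M. real (pulls arm 1 n \<omega>) / real n \<le> x}"
  let ?Q = "\<lambda>\<epsilon> n. prob {\<omega> \<in> space M. \<epsilon> \<le> \<bar>real (pulls arm 1 n \<omega>) / real n - 1 / 2\<bar>}"
  \<comment> \<open>The limit law has an atom at 1/2, so its distribution function jumps there and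
    convergence is only required elsewhere.\<close>
  have "x \<noteq> 1 / 2"
    using cont unfolding R.isCont_cdf by (auto simp: measure_return)
  have lim: "?Q \<epsilon> \<longlonglongrightarrow> 0" if "\<epsilon> > 0" for \<epsilon>
  proof (rule tendsto_sandwich)
    show "\<forall>\<^sub>F n in sequentially. 0 \<le> ?Q \<epsilon> n" by simp
    show "\<forall>\<^sub>F n in sequentially. ?Q \<epsilon> n \<le> 1 / (4 * \<epsilon>\<^sup>2 * real n)"
      using eventually_gt_at_top[of 0]
      by eventually_elim (use prob_pulls_deviation_all_fail[OF assms that] in auto)
    show "(\<lambda>n. 1 / (4 * \<epsilon>\<^sup>2 * real n)) \<longlonglongrightarrow> 0"
      using that by real_asymp
  qed simp
  have "?P \<longlonglongrightarrow> indicator {..x} (1 / 2)"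
  proof (cases "x < 1 / 2")
    case True
    \<comment> \<open>A proportion of at most \<open>x\<close> misses 1/2 by at least
      \<open>1 / 2 - x\<close>.\<close>
    have "?P n \<le> ?Q (1 / 2 - x) n" for n
      by (intro finite_measure_mono) auto
    then have "?P \<longlonglongrightarrow> 0"
      by (intro tendsto_sandwich[OF _ _ tendsto_const lim[of "1 / 2 - x"]]) (use True in auto)
    with True show ?thesis by simp
  next
    case False
    with \<open>x \<noteq> 1 / 2\<close> have gt: "x > 1 / 2" by simp
    \<comment> \<open>On the other side of 1/2 the same bound applies to the complementary
      event.\<close>
    have lower: "1 - ?Q (x - 1 / 2) n \<le> ?P n" for n
    proof -
      have "1 - ?P n = prob {\<omega> \<in> space M. \<not> real (pulls arm 1 n \<omega>) / real n \<le> x}"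
        by (subst prob_neg) auto
      also have "\<dots> \<le> ?Q (x - 1 / 2) n"
        by (intro finite_measure_mono) auto
      finally show ?thesis by simp
    qed
    have "?P \<longlonglongrightarrow> 1 - 0"
    proof (rule tendsto_sandwich)
      show "\<forall>\<^sub>F n in sequentially. 1 - ?Q (x - 1 / 2) n \<le> ?P n"
        using lower by simp
      show "\<forall>\<^sub>F n in sequentially. ?P n \<le> 1" by simp
      show "(\<lambda>n. 1 - ?Q (x - 1 / 2) n) \<longlonglongrightarrow> 1 - 0"
        using gt by (intro tendsto_diff tendsto_const lim) simp
    qed simp
    with gt show ?thesis by simp
  qed
  moreover have "cdf (return borel (1 / 2)) x = indicator {..x} (1 / 2)"
    by (simp add: cdf_def measure_return)
  ultimately show "(\<lambda>n. cdf (distr M borel (\<lambda>\<omega>. real (pulls arm 1 n \<omega>) / real n)) x)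
      \<longlonglongrightarrow> cdf (return borel (1 / 2)) x"
    by (simp only: cdf_proportion)
qed

section \<open>Weak limit when every reward is 1\<close>

text \<open>The count is uniform on \<open>n + 1\<close> values, and those with proportion at most
  \<open>x\<close> are 0 up to the floor of \<open>n * x\<close>, one more than that floor.\<close>

lemma prob_proportion_le_all_succeed:
  assumes "p 1 = 1" "p 2 = 1" "n > 0" "0 \<le> x" "x \<le> 1"
  shows "prob {\<omega> \<in> space M. real (pulls arm 1 n \<omega>) / real n \<le> x}
    = (of_int \<lfloor>real n * x\<rfloor> + 1) / (real n + 1)"
proof -
  let ?E = "{\<omega> \<in> space M. real (pulls arm 1 n \<omega>) / real n \<le> x}"
  let ?k = "nat \<lfloor>real n * x\<rfloor>"
  have k: "real k / real n \<le> x \<longleftrightarrow> k \<le> ?k" for k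
  proof -
    have "real k / real n \<le> x \<longleftrightarrow> real k \<le> real n * x"
      using assms(3) by (simp add: field_simps)
    also have "\<dots> \<longleftrightarrow> k \<le> ?k"
      using assms(4) by (simp add: le_nat_iff le_floor_iff)
    finally show ?thesis .
  qed
  have "real n * x \<le> real n" using assms(4,5) by (intro mult_left_le) auto
  \<comment> \<open>This is where \<open>x \<le> 1\<close> enters: all counted values lie in the
    range of the count.\<close>
  then have "?k \<le> n" by linarith
  have "prob ?E = expectation (indicator ?E)" by simp
  also have "\<dots> = expectation (\<lambda>\<omega>. of_bool (pulls arm 1 n \<omega> \<le> ?k))"
    by (intro Bochner_Integration.integral_cong) (auto simp: k)
  also have "\<dots> = (\<Sum>k\<le>n. of_bool (k \<le> ?k)) / real (n + 1)"
    by (rule expectation_pulls_all_succeed[OF assms(1,2)])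
  also have "(\<Sum>k\<le>n. of_bool (k \<le> ?k) :: real) = (\<Sum>k\<le>?k. 1)"
    using \<open>?k \<le> n\<close> by (intro sum.mono_neutral_cong_right) auto
  finally show ?thesis using assms(4) by (simp add: add.commute)
qed

lemma weak_conv_all_succeed:
  assumes "p 1 = 1" "p 2 = 1"
  shows "weak_conv_m (\<lambda>n. distr M borel (\<lambda>\<omega>. real (pulls arm 1 n \<omega>) / real n))
    (uniform_measure lborel {0..1})"
  unfolding weak_conv_m_def weak_conv_def
proof (intro allI impI)
  fix x :: real
  let ?P = "\<lambda>n. prob {\<omega> \<in> space M. real (pulls arm 1 n \<omega>) / real n \<le> x}"
  have cdf: "cdf (uniform_measure lborel {0..1}) x = measure lborel ({0..1} \<inter> {..x})"
    by (simp add: cdf_def)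
  consider "x < 0" | "x > 1" | "0 \<le> x" "x \<le> 1" by linarith
  then have "?P \<longlonglongrightarrow> measure lborel ({0..1} \<inter> {..x})"
  proof cases
    case 1
    have "?P n = 0" for n
    proof -
      have "\<not> real (pulls arm 1 n \<omega>) / real n \<le> x" for \<omega>
        using 1 divide_nonneg_nonneg[of "real (pulls arm 1 n \<omega>)" "real n"] by linarith
      then show ?thesis by simp
    qed
    moreover have "{0..1} \<inter> {..x} = {}" using 1 by auto
    ultimately show ?thesis by simp
  next
    case 2
    have "?P n = 1" for n
    proof -
      have "real (pulls arm 1 n \<omega>) / real n \<le> x" if "\<omega> \<in> space M" for \<omega>
      proof -
        \<comment> \<open>For \<open>n = 0\<close> the quotient is 0 by the convention for division
          by zero.\<close>
        have "real (pulls arm 1 n \<omega>) / real n \<le> 1"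
          using pulls_le[OF that, of n] by (cases "n = 0") auto
        with 2 show ?thesis by linarith
      qed
      then have "{\<omega> \<in> space M. real (pulls arm 1 n \<omega>) / real n \<le> x} = space M" by auto
      then show ?thesis by (simp add: prob_space)
    qed
    moreover have "{0..1} \<inter> {..x} = {0..1}" using 2 by auto
    ultimately show ?thesis by simp
  next
    case 3
    have "?P \<longlonglongrightarrow> x"
    proof (rule tendsto_sandwich)
      \<comment> \<open>The floor of \<open>n * x\<close> plus 1 lies between \<open>n * x\<close>
        and \<open>n * x + 1\<close>, and both bounds divided by \<open>n + 1\<close> tend to
        \<open>x\<close>.\<close>
      show "\<forall>\<^sub>F n in sequentially. real n * x / (real n + 1) \<le> ?P n"
        using eventually_gt_at_top[of 0]
      proof eventually_elim
        case (elim n)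
        then show ?case
          by (subst prob_proportion_le_all_succeed[OF assms elim 3], intro divide_right_mono) linarith+
      qed
      show "\<forall>\<^sub>F n in sequentially. ?P n \<le> (real n * x + 1) / (real n + 1)"
        using eventually_gt_at_top[of 0]
      proof eventually_elim
        case (elim n)
        then show ?case
          by (subst prob_proportion_le_all_succeed[OF assms elim 3], intro divide_right_mono) linarith+
      qed
      show "(\<lambda>n. real n * x / (real n + 1)) \<longlonglongrightarrow> x" by real_asymp
      show "(\<lambda>n. (real n * x + 1) / (real n + 1)) \<longlonglongrightarrow> x" by real_asymp
    qed
    moreover have "{0..1} \<inter> {..x} = {0..x}" using 3 by auto
    ultimately show ?thesis using 3 by simp
  qed
  then show "(\<lambda>n. cdf (distr M borel (\<lambda>\<omega>. real (pulls arm 1 n \<omega>) / real n)) x)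
      \<longlonglongrightarrow> cdf (uniform_measure lborel {0..1}) x"
    by (simp only: cdf_proportion cdf)
qed

end

theorem theorem3:
  fixes M :: "'a measure" and q :: real
    and \<T> :: "nat \<Rightarrow> nat \<Rightarrow> 'a \<Rightarrow> real"
    and arm :: "nat \<Rightarrow> 'a \<Rightarrow> nat"
    and X :: "nat \<Rightarrow> nat \<Rightarrow> 'a \<Rightarrow> bool"
  assumes "thompson_sampling M (\<lambda>_. q) \<T> arm X"
  shows "(q = 0 \<longrightarrow>
           weak_conv_m (\<lambda>n. distr M borel (\<lambda>\<omega>. real (pulls arm 1 n \<omega>) / real n))
             (return borel (1 / 2))) \<and>
         (q = 1 \<longrightarrow>
           weak_conv_m (\<lambda>n. distr M borel (\<lambda>\<omega>. real (pulls arm 1 n \<omega>) / real n))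
             (uniform_measure lborel {0..1}))"
proof -
  interpret thompson_sampling M "\<lambda>_. q" \<T> arm X by fact
  show ?thesis
    using weak_conv_all_fail weak_conv_all_succeed by simp
qed

end
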